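(* Let $d\ge2$ and $1\le k<d$ be integers and let $f$ be a probability density on $\mathbb{R}^d$ that is almost everywhere bounded and continuous. For each choice of sign $\pm$, let $\mathcal{G}_k^{\pm}(t)=\int_{\mathbb{R}^{d(k+1)}}h_t^{\pm}(0,\mathbf{y})\,G_k(d\mathbf{y})$, $t\ge0$. Then $$\big(\mathcal{G}_k^{\pm}(t),\ t\ge0\big)\overset{d}{=}\Big(B\big(C_{f,k}\,m_k(D_1^{\pm})\,t^{d(k+1)}\big),\ t\ge0\Big),$$ where $B$ is a standard Brownian motion and $D_t^{\pm}=\{\mathbf{y}\in\mathbb{R}^{d(k+1)}:h_t^{\pm}(0,\mathbf{y})=1\}$.
   Context: Notation. $B(x;r)=\{y\in\mathbb{R}^d:|x-y|<r\}$ (with two arguments; an open ball). For $x_1,\dots,x_{k+2}\in\mathbb{R}^d$ and $t\ge0$, $$h_t^+(x_1,\dots,x_{k+2})=\prod_{i=1}^{k+2}\mathbf{1}\Big\{\bigcap_{j=1,\,j\ne i}^{k+2}B(x_j;t/2)\neq\emptyset\Big\},\qquad h_t^-(x_1,\dots,x_{k+2})=\mathbf{1}\Big\{\bigcap_{j=1}^{k+2}B(x_j;t/2)\ne\emptyset\Big\}.$$ For $\mathbf{y}=(y_1,\dots,y_{k+1})\in\mathbb{R}^{d(k+1)}$, $h_t^\pm(0,\mathbf{y})=h_t^\pm(0,y_1,\dots,y_{k+1})$. $m_k$ denotes Lebesgue measure on $\mathbb{R}^{d(k+1)}$ and $C_{f,k}=\frac{1}{(k+2)!}\int_{\mathbb{R}^d}f(x)^{k+2}\,dx$.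 $G_k$ is a Gaussian random measure on $\mathbb{R}^{d(k+1)}$ with control measure $C_{f,k}m_k$: $G_k(A)\sim\mathcal{N}(0,C_{f,k}m_k(A))$ for measurable $A$ (of finite measure), with $G_k(A_1),\dots,G_k(A_m)$ independent for disjoint $A_1,\dots,A_m$; the integral is the usual stochastic integral with respect to $G_k$. $\overset{d}{=}$ denotes equality of finite-dimensional distributions. *)

theory Defs
  imports "HOL-Probability.Probability"
begin

text \<open>
  A tuple \<open>(x\<^sub>1, \<dots>, x\<^sub>n)\<close> of points is a function on \<open>nat\<close> of which only the values at
  \<open>1, \<dots>, n\<close> matter.
\<close>

definition h_plus :: "nat \<Rightarrow> real \<Rightarrow> (nat \<Rightarrow> real ^ 'd) \<Rightarrow> real" where
  "h_plus k t x =
     (\<Prod>i\<in>{1..k+2}. of_bool ((\<Inter>j\<in>{1..k+2} - {i}. ball (x j) (t / 2)) \<noteq> {}))"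

definition h_minus :: "nat \<Rightarrow> real \<Rightarrow> (nat \<Rightarrow> real ^ 'd) \<Rightarrow> real" where
  "h_minus k t x = of_bool ((\<Inter>j\<in>{1..k+2}. ball (x j) (t / 2)) \<noteq> {})"

text \<open>The tuple \<open>(0, y\<^sub>1, \<dots>, y\<^sub>n)\<close>, again indexed from \<open>1\<close>.\<close>

definition cons0 :: "(nat \<Rightarrow> real ^ 'd) \<Rightarrow> nat \<Rightarrow> real ^ 'd" where
  "cons0 y = (\<lambda>i. if i = 1 then 0 else y (i - 1))"

text \<open>
  Lebesgue measure on the Borel sets of \<open>\<real>\<^sup>d\<^sup>(\<^sup>k\<^sup>+\<^sup>1\<^sup>)\<close>, viewed as \<open>(\<real>\<^sup>d)\<^sup>k\<^sup>+\<^sup>1\<close>; its points are the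
  functions on \<open>{1..k+1}\<close> that are undefined elsewhere.
\<close>

definition m_k :: "nat \<Rightarrow> (nat \<Rightarrow> real ^ 'd) measure" where
  "m_k k = (\<Pi>\<^sub>M i\<in>{1..k+1}. lborel)"

definition D_set ::
    "nat \<Rightarrow> (real \<Rightarrow> (nat \<Rightarrow> real ^ 'd) \<Rightarrow> real) \<Rightarrow> real \<Rightarrow> (nat \<Rightarrow> real ^ 'd) set" where
  "D_set k h t = {y \<in> space (m_k k). h t (cons0 y) = 1}"

definition prob_density :: "(real ^ 'd \<Rightarrow> real) \<Rightarrow> bool" where
  "prob_density f \<longleftrightarrow>
     f \<in> borel_measurable lebesgue \<and> (\<forall>x. 0 \<le> f x) \<and> (\<integral>\<^sup>+x. ennreal (f x) \<partial>lebesgue) = 1"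

definition C_const :: "(real ^ 'd \<Rightarrow> real) \<Rightarrow> nat \<Rightarrow> real" where
  "C_const f k = 1 / fact (k + 2) * (LINT x|lebesgue. f x ^ (k + 2))"

text \<open>The law \<open>N(\<mu>, v)\<close> with variance \<open>v \<ge> 0\<close>; the library density does not cover \<open>v = 0\<close>.\<close>

definition normal_law :: "real \<Rightarrow> real \<Rightarrow> real measure" where
  "normal_law \<mu> v =
     (if v = 0 then return borel \<mu> else density lborel (normal_density \<mu> (sqrt v)))"

text \<open>
  \<open>G\<close> matters only on sets of finite control measure. That \<open>G\<close> is a random \<^emph>\<open>measure\<close> means
  that it is countably additive almost surely, the null set depending on the sequence of sets.
\<close>

definition gaussian_random_measure ::
    "'w measure \<Rightarrow> 'b measure \<Rightarrow> ('b set \<Rightarrow> 'w \<Rightarrow> real) \<Rightarrow> bool" where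
  "gaussian_random_measure M \<nu> G \<longleftrightarrow>
     prob_space M \<and>
     (\<forall>A\<in>sets \<nu>. emeasure \<nu> A < \<infinity> \<longrightarrow>
        G A \<in> borel_measurable M \<and> distr M borel (G A) = normal_law 0 (measure \<nu> A)) \<and>
     (\<forall>(A :: nat \<Rightarrow> 'b set) m.
        (\<forall>i<m. A i \<in> sets \<nu> \<and> emeasure \<nu> (A i) < \<infinity>) \<and> disjoint_family_on A {..<m} \<longrightarrow>
        prob_space.indep_vars M (\<lambda>_. borel) (\<lambda>i. G (A i)) {..<m}) \<and>
     (\<forall>A :: nat \<Rightarrow> 'b set.
        range A \<subseteq> sets \<nu> \<and> disjoint_family A \<and> emeasure \<nu> (\<Union>i. A i) < \<infinity> \<longrightarrow>
        (AE w in M. (\<lambda>i. G (A i) w) sums G (\<Union>i. A i) w))"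

text \<open>The value \<open>0\<close>, whose level set may have infinite measure, does not contribute.\<close>

definition simple_gaussian_integral ::
    "'b measure \<Rightarrow> ('b set \<Rightarrow> 'w \<Rightarrow> real) \<Rightarrow> ('b \<Rightarrow> real) \<Rightarrow> 'w \<Rightarrow> real" where
  "simple_gaussian_integral \<nu> G s w =
     (\<Sum>c\<in>s ` space \<nu>. c * G {x \<in> space \<nu>. s x = c} w)"

text \<open>
  The integral of a square-integrable function is the \<open>L\<^sup>2\<close>-limit of the integrals of simple
  functions converging to it in \<open>L\<^sup>2(\<nu>)\<close>. It is determined only up to almost sure equality;
  \<open>gaussian_integral\<close> picks a version.
\<close>

definition has_gaussian_integral ::
    "'w measure \<Rightarrow> 'b measure \<Rightarrow> ('b set \<Rightarrow> 'w \<Rightarrow> real) \<Rightarrow> ('b \<Rightarrow> real) \<Rightarrow> ('w \<Rightarrow> real) \<Rightarrow> bool" where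
  "has_gaussian_integral M \<nu> G g I \<longleftrightarrow>
     g \<in> borel_measurable \<nu> \<and> I \<in> borel_measurable M \<and>
     (\<exists>s :: nat \<Rightarrow> 'b \<Rightarrow> real.
        (\<forall>n. simple_function \<nu> (s n) \<and> emeasure \<nu> {x \<in> space \<nu>. s n x \<noteq> 0} < \<infinity>) \<and>
        (\<lambda>n. \<integral>\<^sup>+x. ennreal ((s n x - g x)\<^sup>2) \<partial>\<nu>) \<longlonglongrightarrow> 0 \<and>
        (\<lambda>n. \<integral>\<^sup>+w. ennreal ((simple_gaussian_integral \<nu> G (s n) w - I w)\<^sup>2) \<partial>M) \<longlonglongrightarrow> 0)"

definition gaussian_integral ::
    "'w measure \<Rightarrow> 'b measure \<Rightarrow> ('b set \<Rightarrow> 'w \<Rightarrow> real) \<Rightarrow> ('b \<Rightarrow> real) \<Rightarrow> 'w \<Rightarrow> real" where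
  "gaussian_integral M \<nu> G g = (SOME I. has_gaussian_integral M \<nu> G g I)"

definition standard_brownian_motion :: "'v measure \<Rightarrow> (real \<Rightarrow> 'v \<Rightarrow> real) \<Rightarrow> bool" where
  "standard_brownian_motion N B \<longleftrightarrow>
     prob_space N \<and>
     (\<forall>t\<ge>0. B t \<in> borel_measurable N) \<and>
     (AE w in N. B 0 w = 0) \<and>
     (\<forall>s t. 0 \<le> s \<and> s \<le> t \<longrightarrow>
        distr N borel (\<lambda>w. B t w - B s w) = normal_law 0 (t - s)) \<and>
     (\<forall>(\<tau> :: nat \<Rightarrow> real) n. 0 \<le> \<tau> 0 \<and> mono_on {..n} \<tau> \<longrightarrow>
        prob_space.indep_vars N (\<lambda>_. borel) (\<lambda>i w. B (\<tau> (Suc i)) w - B (\<tau> i) w) {..<n}) \<and>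
     (AE w in N. continuous_on {0..} (\<lambda>t. B t w))"

definition fdd_eq ::
    "'w measure \<Rightarrow> 'v measure \<Rightarrow> 't set \<Rightarrow> ('t \<Rightarrow> 'w \<Rightarrow> real) \<Rightarrow> ('t \<Rightarrow> 'v \<Rightarrow> real) \<Rightarrow> bool" where
  "fdd_eq M N T X Y \<longleftrightarrow>
     (\<forall>t\<in>T. X t \<in> borel_measurable M \<and> Y t \<in> borel_measurable N) \<and>
     (\<forall>J. finite J \<and> J \<subseteq> T \<longrightarrow>
        distr M (\<Pi>\<^sub>M t\<in>J. borel) (\<lambda>w. \<lambda>t\<in>J. X t w) =
        distr N (\<Pi>\<^sub>M t\<in>J. borel) (\<lambda>w. \<lambda>t\<in>J. Y t w))"

end

theory Submission
  imports Defs
begin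

text \<open>
  The sets \<open>D\<^sub>t\<close> increase with \<open>t\<close>, so that \<open>\<G>(t) = G(D\<^sub>t)\<close> has independent increments
  \<open>G(D\<^sub>t - D\<^sub>s)\<close>, which are centred Gaussian with variance \<open>\<nu>(D\<^sub>t) - \<nu>(D\<^sub>s)\<close> for the control measure
  \<open>\<nu>\<close>. As \<open>D\<^sub>t = t D\<^sub>1\<close>, the function \<open>\<nu>(D\<^sub>t)\<close> is \<open>\<nu>(D\<^sub>1)\<close> times the power \<open>d(k+1)\<close> of \<open>t\<close>, and a process
  that starts in \<open>0\<close> and has independent increments is determined in law by the laws of its increments.
  That the integral of an indicator is \<open>G(D\<^sub>t)\<close>, whatever the approximating simple functions, is the
  Ito isometry.
\<close>

section \<open>Gaussian random measures\<close>

lemma has_bochner_integral_return: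
  fixes f :: "'a \<Rightarrow> real"
  assumes f: "f \<in> borel_measurable M" and x: "x \<in> space M"
  shows "has_bochner_integral (return M x) f (f x)"
  unfolding has_bochner_integral_iff integrable_iff_bounded
proof (intro conjI)
  show "(\<integral>\<^sup>+y. ennreal (norm (f y)) \<partial>return M x) < \<infinity>"
    using assms by (subst nn_integral_return) auto
  show "integral\<^sup>L (return M x) f = f x"
    using x f by (rule integral_return)
qed (use f in simp)

text \<open>The case split mirrors the definition: variance zero means the point mass at 0, and
  otherwise the moments are those of a normal density.\<close>

lemma normal_law_moments:
  assumes "0 \<le> v"
  shows "has_bochner_integral (normal_law 0 v) (\<lambda>x. x) 0" (is ?mean)
    and "has_bochner_integral (normal_law 0 v) (\<lambda>x. x\<^sup>2) v" (is ?variance)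
proof -
  have "?mean \<and> ?variance"
  proof (cases "v = 0")
    case True
    have "has_bochner_integral (return borel 0) (\<lambda>x::real. x) 0"
      by (rule has_bochner_integral_return[where f="\<lambda>x. x"]) auto
    moreover have "has_bochner_integral (return borel 0) (\<lambda>x::real. x\<^sup>2) 0"
      by (rule has_bochner_integral_return[where f="\<lambda>x. x\<^sup>2" and x=0, unfolded zero_power2]) auto
    ultimately show ?thesis
      unfolding normal_law_def if_P[OF True] unfolding True by (rule conjI)
  next
    case False
    with assms have pos: "0 < sqrt v" by simp
    have "has_bochner_integral lborel (\<lambda>x. normal_density 0 (sqrt v) x * x) 0"
      using normal_moment_nz_1[OF pos, of 0] .
    moreover have "has_bochner_integral lborel (\<lambda>x. normal_density 0 (sqrt v) x * x\<^sup>2) v"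
      using normal_moment_even[OF pos, of 0 1] assms by simp
    ultimately show ?thesis
      using False by (auto simp: normal_law_def intro!: has_bochner_integral_density)
  qed
  then show ?mean ?variance by blast+
qed

context
  fixes M :: "'w measure" and \<nu> :: "'b measure" and G :: "'b set \<Rightarrow> 'w \<Rightarrow> real"
  assumes grm: "gaussian_random_measure M \<nu> G"
begin

interpretation prob_space M
  using grm by (simp add: gaussian_random_measure_def)

lemma grm_measurable:
  assumes "A \<in> sets \<nu>" "emeasure \<nu> A < \<infinity>"
  shows "G A \<in> borel_measurable M"
  using grm assms by (simp add: gaussian_random_measure_def)

lemma grm_law:
  assumes "A \<in> sets \<nu>" "emeasure \<nu> A < \<infinity>"
  shows "distr M borel (G A) = normal_law 0 (measure \<nu> A)"
  using grm assms by (simp add: gaussian_random_measure_def)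

lemma grm_indep:
  fixes A :: "nat \<Rightarrow> 'b set"
  assumes "\<And>i. i < m \<Longrightarrow> A i \<in> sets \<nu>" "\<And>i. i < m \<Longrightarrow> emeasure \<nu> (A i) < \<infinity>"
    and "disjoint_family_on A {..<m}"
  shows "indep_vars (\<lambda>_. borel) (\<lambda>i. G (A i)) {..<m}"
  using grm assms unfolding gaussian_random_measure_def by blast

section \<open>Second moments of a Gaussian random measure\<close>

lemma grm_has_expectation:
  assumes A: "A \<in> sets \<nu>" "emeasure \<nu> A < \<infinity>"
  shows "has_bochner_integral M (G A) 0"
    and "has_bochner_integral M (\<lambda>w. (G A w)\<^sup>2) (measure \<nu> A)"
proof -
  note [measurable] = grm_measurable[OF A]
  have m: "has_bochner_integral (distr M borel (G A)) (\<lambda>x. x) 0"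
    "has_bochner_integral (distr M borel (G A)) (\<lambda>x. x\<^sup>2) (measure \<nu> A)"
    unfolding grm_law[OF A] by (rule normal_law_moments; simp)+
  from m(1) show "has_bochner_integral M (G A) 0"
    by (simp add: has_bochner_integral_iff integrable_distr_eq integral_distr)
  from m(2) show "has_bochner_integral M (\<lambda>w. (G A w)\<^sup>2) (measure \<nu> A)"
    by (simp add: has_bochner_integral_iff integrable_distr_eq integral_distr)
qed

text \<open>Values on disjoint sets are independent and centred, so the expectation of the product
  factors into a product of zeros.\<close>

lemma grm_orthogonal:
  assumes A: "A \<in> sets \<nu>" "emeasure \<nu> A < \<infinity>" and B: "B \<in> sets \<nu>" "emeasure \<nu> B < \<infinity>"
    and "A \<inter> B = {}"
  shows "has_bochner_integral M (\<lambda>w. G A w * G B w) 0"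
proof -
  \<comment> \<open>Independence is given for families over an initial segment of the naturals, so
    the pair is coded as a family over \<open>{..<2}\<close>.\<close>
  define F where "F i = (if i = 0 then A else B)" for i :: nat
  have F: "F i \<in> sets \<nu>" "emeasure \<nu> (F i) < \<infinity>" for i
    using A B by (auto simp: F_def)
  have "disjoint_family_on F {..<2}"
    using \<open>A \<inter> B = {}\<close> by (auto simp: disjoint_family_on_def F_def)
  then have ind: "indep_vars (\<lambda>_. borel) (\<lambda>i. G (F i)) {..<2}"
    using F by (intro grm_indep)
  have i: "integrable M (G (F i))" "integral\<^sup>L M (G (F i)) = 0" for i
    using grm_has_expectation(1)[OF F] by (auto simp: has_bochner_integral_iff)
  have "integrable M (\<lambda>w. \<Prod>i<2. G (F i) w)"
    using ind i by (intro indep_vars_integrable) auto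
  moreover have "(\<integral>w. (\<Prod>i<2. G (F i) w) \<partial>M) = (\<Prod>i<(2::nat). \<integral>w. G (F i) w \<partial>M)"
    using ind i by (intro indep_vars_lebesgue_integral) auto
  ultimately show ?thesis
    using i[of 0] by (simp add: has_bochner_integral_iff numeral_2_eq_2 F_def)
qed

text \<open>Squaring the sum gives a double sum whose mixed terms vanish in expectation by
  orthogonality; the diagonal contributes the variances. The integral takes values in
  \<open>ennreal\<close> to match the one in \<open>has_gaussian_integral\<close>.\<close>

lemma grm_isometry:
  fixes A :: "'i \<Rightarrow> 'b set" and a :: "'i \<Rightarrow> real"
  assumes I: "finite I" and A: "\<And>i. i \<in> I \<Longrightarrow> A i \<in> sets \<nu>" "\<And>i. i \<in> I \<Longrightarrow> emeasure \<nu> (A i) < \<infinity>"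
    and disj: "disjoint_family_on A I"
  shows "(\<integral>\<^sup>+w. ennreal ((\<Sum>i\<in>I. a i * G (A i) w)\<^sup>2) \<partial>M) = (\<Sum>i\<in>I. ennreal ((a i)\<^sup>2) * emeasure \<nu> (A i))"
proof -
  have "has_bochner_integral M (\<lambda>w. \<Sum>i\<in>I. \<Sum>j\<in>I. (a i * a j) * (G (A i) w * G (A j) w))
      (\<Sum>i\<in>I. \<Sum>j\<in>I. (a i * a j) * (if i = j then measure \<nu> (A i) else 0))"
  proof (intro has_bochner_integral_sum has_bochner_integral_mult_right)
    fix i j assume ij: "i \<in> I" "j \<in> I"
    show "has_bochner_integral M (\<lambda>w. G (A i) w * G (A j) w) (if i = j then measure \<nu> (A i) else 0)"
    proof (cases "i = j")
      case True
      then show ?thesis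
        using grm_has_expectation(2)[OF A(1,2), of i] ij by (simp add: power2_eq_square)
    next
      case False
      then show ?thesis
        using grm_orthogonal[OF A(1,2) A(1,2), of i j] ij disj by (simp add: disjoint_family_on_def)
    qed
  qed
  moreover have "(\<Sum>i\<in>I. \<Sum>j\<in>I. (a i * a j) * (G (A i) w * G (A j) w)) = (\<Sum>i\<in>I. a i * G (A i) w)\<^sup>2" for w
    by (simp add: power2_eq_square sum_product ac_simps)
  moreover have "(\<Sum>i\<in>I. \<Sum>j\<in>I. (a i * a j) * (if i = j then measure \<nu> (A i) else 0)) =
      (\<Sum>i\<in>I. (a i)\<^sup>2 * measure \<nu> (A i))"
    using I by (simp add: if_distrib[where f="\<lambda>x. _ * x"] power2_eq_square cong: if_cong)
  ultimately have "has_bochner_integral M (\<lambda>w. (\<Sum>i\<in>I. a i * G (A i) w)\<^sup>2) (\<Sum>i\<in>I. (a i)\<^sup>2 * measure \<nu> (A i))"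
    by simp
  then have "(\<integral>\<^sup>+w. ennreal ((\<Sum>i\<in>I. a i * G (A i) w)\<^sup>2) \<partial>M) = ennreal (\<Sum>i\<in>I. (a i)\<^sup>2 * measure \<nu> (A i))"
    by (subst nn_integral_eq_integral) (auto simp: has_bochner_integral_iff)
  also have "\<dots> = (\<Sum>i\<in>I. ennreal ((a i)\<^sup>2) * emeasure \<nu> (A i))"
    using A(2) by (subst sum_ennreal[symmetric])
      (auto simp: ennreal_mult emeasure_eq_ennreal_measure less_top intro!: sum.cong)
  finally show ?thesis .
qed

section \<open>Almost sure finite additivity\<close>

lemma grm_empty: "AE w in M. G {} w = 0"
proof -
  have "distr M borel (G {}) = return borel 0"
    using grm_law[of "{}"] by (simp add: normal_law_def)
  moreover have "AE x in return borel (0::real). x = 0"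
    by (subst AE_return) auto
  ultimately have "AE x in distr M borel (G {}). x = 0" by (simp only:)
  then show ?thesis
    by (subst (asm) AE_distr_iff) (auto intro: grm_measurable)
qed

text \<open>Countable additivity is applied to an enumeration of \<open>I\<close> continued by empty
  sets, on which \<open>G\<close> vanishes almost surely.\<close>

lemma grm_finite_additive:
  fixes A :: "'i \<Rightarrow> 'b set"
  assumes I: "finite I" and A: "\<And>i. i \<in> I \<Longrightarrow> A i \<in> sets \<nu>" "\<And>i. i \<in> I \<Longrightarrow> emeasure \<nu> (A i) < \<infinity>"
    and disj: "disjoint_family_on A I"
  shows "AE w in M. G (\<Union>i\<in>I. A i) w = (\<Sum>i\<in>I. G (A i) w)"
proof -
  obtain e where e: "bij_betw e {..<card I} I"
    using bij_betw_from_nat_into_finite[OF I] by blast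
  define F where "F n = (if n < card I then A (e n) else {})" for n
  have eI: "e n \<in> I" if "n < card I" for n
    using e that by (auto dest: bij_betwE)
  have UF: "(\<Union>n. F n) = (\<Union>i\<in>I. A i)"
    using bij_betw_imp_surj_on[OF e] by (force simp: F_def split: if_splits)
  have "range F \<subseteq> sets \<nu>"
    using A eI by (auto simp: F_def)
  moreover have "disjoint_family F"
    unfolding disjoint_family_on_def
  proof (intro ballI impI)
    fix m n :: nat assume "m \<noteq> n"
    then have "e m \<noteq> e n" if "m < card I" "n < card I"
      using that e by (auto simp: bij_betw_def inj_on_def)
    then show "F m \<inter> F n = {}"
      using disj eI by (auto simp: F_def disjoint_family_on_def)
  qed
  moreover have "emeasure \<nu> (\<Union>n. F n) < \<infinity>"
    unfolding UF using A I by (intro le_less_trans[OF emeasure_subadditive_finite]) auto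
  ultimately have "AE w in M. (\<lambda>n. G (F n) w) sums G (\<Union>n. F n) w"
    using grm by (simp add: gaussian_random_measure_def)
  then show ?thesis
    using grm_empty
  proof eventually_elim
    case (elim w)
    have "(\<lambda>n. G (F n) w) sums (\<Sum>n<card I. G (F n) w)"
      using elim(2) by (intro sums_finite) (auto simp: F_def)
    moreover have "(\<Sum>n<card I. G (F n) w) = (\<Sum>i\<in>I. G (A i) w)"
      by (simp add: F_def sum.reindex_bij_betw[OF e, symmetric])
    ultimately show ?case
      using elim(1) sums_unique2 unfolding UF by metis
  qed
qed

lemma grm_diff:
  assumes "A \<in> sets \<nu>" "B \<in> sets \<nu>" "A \<subseteq> B" "emeasure \<nu> B < \<infinity>"
  shows "AE w in M. G B w - G A w = G (B - A) w"
proof -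
  have fin: "emeasure \<nu> A < \<infinity>" "emeasure \<nu> (B - A) < \<infinity>"
    using emeasure_mono[of A B \<nu>] emeasure_mono[of "B - A" B \<nu>] assms by (auto intro: le_less_trans)
  \<comment> \<open>\<open>B\<close> is split into \<open>A\<close> and \<open>B - A\<close>, a
    disjoint family indexed by the two Booleans.\<close>
  have "AE w in M. G (\<Union>b\<in>UNIV. case_bool A (B - A) b) w = (\<Sum>b\<in>UNIV. G (case_bool A (B - A) b) w)"
    using assms fin by (intro grm_finite_additive) (auto simp: disjoint_family_on_def split: bool.splits)
  then show ?thesis
    using \<open>A \<subseteq> B\<close> by (simp add: UNIV_bool Un_absorb2 algebra_simps)
qed

section \<open>Integrals of simple functions and of indicators\<close>

lemma simple_gaussian_integral_measurable:
  assumes s: "simple_function \<nu> s" and fin: "emeasure \<nu> {x \<in> space \<nu>. s x \<noteq> 0} < \<infinity>"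
  shows "simple_gaussian_integral \<nu> G s \<in> borel_measurable M"
proof -
  have "(\<lambda>w. c * G {x \<in> space \<nu>. s x = c} w) \<in> borel_measurable M" for c
  \<comment> \<open>The level set of 0 may have infinite measure, where nothing is known about
    \<open>G\<close>; its zero coefficient makes the summand constant. Every other level set lies in
    the support of \<open>s\<close>.\<close>
  proof (cases "c = 0")
    case False
    have [measurable]: "s \<in> borel_measurable \<nu>"
      using s by (rule borel_measurable_simple_function)
    have "emeasure \<nu> {x \<in> space \<nu>. s x = c} \<le> emeasure \<nu> {x \<in> space \<nu>. s x \<noteq> 0}"
      using False by (intro emeasure_mono) auto
    with fin have "G {x \<in> space \<nu>. s x = c} \<in> borel_measurable M"
      by (intro grm_measurable) auto
    then show ?thesis by simp
  qed simp
  then show ?thesis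
    unfolding simple_gaussian_integral_def[abs_def] by (intro borel_measurable_sum)
qed

text \<open>The level sets of \<open>s\<close> and the set \<open>D\<close> have a common refinement
  on whose pieces \<open>s - indicator D\<close> is constant. By finite additivity the difference is
  almost surely a combination of the values of \<open>G\<close> on these pieces, to which
  \<open>grm_isometry\<close> applies.\<close>

lemma simple_gaussian_integral_isometry:
  assumes s: "simple_function \<nu> s" and fin: "emeasure \<nu> {x \<in> space \<nu>. s x \<noteq> 0} < \<infinity>"
    and D: "D \<in> sets \<nu>" "emeasure \<nu> D < \<infinity>"
  shows "(\<integral>\<^sup>+w. ennreal ((simple_gaussian_integral \<nu> G s w - G D w)\<^sup>2) \<partial>M) =
    (\<integral>\<^sup>+x. ennreal ((s x - indicator D x)\<^sup>2) \<partial>\<nu>)"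
proof -
  define V where "V = s ` space \<nu>"
  define A where "A = (\<lambda>(c, b). {x \<in> space \<nu>. s x = c \<and> (x \<in> D \<longleftrightarrow> b)})"
  \<comment> \<open>The piece \<open>(0, False)\<close> may have infinite measure, but its coefficient vanishes.\<close>
  define I where "I = V \<times> UNIV - {(0::real, False)}"
  \<comment> \<open>The constant value of \<open>s - indicator D\<close> on the piece
    \<open>A (c, b)\<close>.\<close>
  define a where "a = (\<lambda>(c::real, b). c - of_bool b)"
  have [measurable]: "s \<in> borel_measurable \<nu>"
    using s by (rule borel_measurable_simple_function)
  note [measurable] = D(1)
  have DS: "D \<subseteq> space \<nu>" using D(1) by (rule sets.sets_into_space)
  have finV: "finite V" using s by (simp add: simple_function_def V_def)
  then have finI: "finite I" by (simp add: I_def)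
  have sA[measurable]: "A i \<in> sets \<nu>" for i
    by (cases i) (simp add: A_def)
  have fA: "emeasure \<nu> (A i) < \<infinity>" if "i \<noteq> (0, False)" for i
  proof -
    have "A i \<subseteq> {x \<in> space \<nu>. s x \<noteq> 0} \<union> D"
      using that by (cases i) (auto simp: A_def)
    then have "emeasure \<nu> (A i) \<le> emeasure \<nu> ({x \<in> space \<nu>. s x \<noteq> 0} \<union> D)"
      by (intro emeasure_mono) auto
    also have "\<dots> \<le> emeasure \<nu> {x \<in> space \<nu>. s x \<noteq> 0} + emeasure \<nu> D"
      by (intro emeasure_subadditive) auto
    also have "\<dots> < \<infinity>" using fin D(2) by simp
    finally show ?thesis .
  qed
  have disj: "disjoint_family A"
    unfolding disjoint_family_on_def
  proof (intro ballI impI)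
    fix i j :: "real \<times> bool" assume "i \<noteq> j"
    then show "A i \<inter> A j = {}"
      by (cases i; cases j) (auto simp: A_def)
  qed
  \<comment> \<open>A nonzero level set splits almost surely over its two pieces; for
    \<open>c = 0\<close> both sides are zero whatever \<open>G\<close> does. As \<open>V\<close> is
    finite, one null set serves all its elements.\<close>
  have eqc: "AE w in M. \<forall>c\<in>V. c * G {x \<in> space \<nu>. s x = c} w = (\<Sum>b\<in>UNIV. c * G (A (c, b)) w)"
  proof (subst AE_ball_countable)
    show "countable V" using finV by (rule countable_finite)
    show "\<forall>c\<in>V. AE w in M. c * G {x \<in> space \<nu>. s x = c} w = (\<Sum>b\<in>UNIV. c * G (A (c, b)) w)"
    proof
      fix c assume "c \<in> V"
      show "AE w in M. c * G {x \<in> space \<nu>. s x = c} w = (\<Sum>b\<in>UNIV. c * G (A (c, b)) w)"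
      proof (cases "c = 0")
        case False
        have "{x \<in> space \<nu>. s x = c} = (\<Union>b\<in>UNIV. A (c, b))"
          by (auto simp: A_def)
        moreover have "AE w in M. G (\<Union>b\<in>UNIV. A (c, b)) w = (\<Sum>b\<in>UNIV. G (A (c, b)) w)"
          using fA disj False by (intro grm_finite_additive) (auto simp: disjoint_family_on_def)
        ultimately show ?thesis
          by (simp add: sum_distrib_left[symmetric])
      qed simp
    qed
  qed
  have "D = (\<Union>c\<in>V. A (c, True))"
    using DS by (auto simp: A_def V_def)
  moreover have "AE w in M. G (\<Union>c\<in>V. A (c, True)) w = (\<Sum>c\<in>V. G (A (c, True)) w)"
    using fA disj finV by (intro grm_finite_additive) (auto simp: disjoint_family_on_def)
  ultimately have eqD: "AE w in M. G D w = (\<Sum>c\<in>V. G (A (c, True)) w)" by simp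
  have "AE w in M. simple_gaussian_integral \<nu> G s w - G D w = (\<Sum>i\<in>I. a i * G (A i) w)"
    using eqc eqD
  proof eventually_elim
    case (elim w)
    have "simple_gaussian_integral \<nu> G s w - G D w =
        (\<Sum>c\<in>V. (\<Sum>b\<in>UNIV. c * G (A (c, b)) w) - G (A (c, True)) w)"
      using elim by (simp add: simple_gaussian_integral_def V_def[symmetric] sum_subtractf)
    also have "\<dots> = (\<Sum>c\<in>V. \<Sum>b\<in>UNIV. a (c, b) * G (A (c, b)) w)"
      by (simp add: UNIV_bool a_def algebra_simps)
    also have "\<dots> = (\<Sum>i\<in>V \<times> UNIV. a i * G (A i) w)"
      by (simp add: sum.cartesian_product)
    also have "\<dots> = (\<Sum>i\<in>I. a i * G (A i) w)"
      using finV by (intro sum.mono_neutral_right) (auto simp: I_def a_def)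
    finally show ?case .
  qed
  then have "(\<integral>\<^sup>+w. ennreal ((simple_gaussian_integral \<nu> G s w - G D w)\<^sup>2) \<partial>M) =
      (\<integral>\<^sup>+w. ennreal ((\<Sum>i\<in>I. a i * G (A i) w)\<^sup>2) \<partial>M)"
    by (intro nn_integral_cong_AE) auto
  also have "\<dots> = (\<Sum>i\<in>I. ennreal ((a i)\<^sup>2) * emeasure \<nu> (A i))"
    using finI fA disjoint_family_on_mono[OF subset_UNIV disj] by (intro grm_isometry) (auto simp: I_def)
  also have "\<dots> = (\<integral>\<^sup>+x. (\<Sum>i\<in>I. ennreal ((a i)\<^sup>2) * indicator (A i) x) \<partial>\<nu>)"
    by (subst nn_integral_sum) (auto simp: nn_integral_cmult_indicator)
  also have "\<dots> = (\<integral>\<^sup>+x. ennreal ((s x - indicator D x)\<^sup>2) \<partial>\<nu>)"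
  proof (rule nn_integral_cong)
    fix x assume x: "x \<in> space \<nu>"
    \<comment> \<open>\<open>x\<close> lies in exactly one piece, the one with index
      \<open>i\<close>, so the sum has a single term. The index left out of \<open>I\<close> is put
      back first; its coefficient is zero.\<close>
    define i where "i = (s x, x \<in> D)"
    have "(\<Sum>j\<in>I. ennreal ((a j)\<^sup>2) * indicator (A j) x) = (\<Sum>j\<in>V \<times> UNIV. ennreal ((a j)\<^sup>2) * indicator (A j) x)"
      using finV by (intro sum.mono_neutral_left) (auto simp: I_def a_def)
    also have "\<dots> = (\<Sum>j\<in>V \<times> UNIV. if j = i then ennreal ((a j)\<^sup>2) else 0)"
      using x by (intro sum.cong) (auto simp: A_def i_def indicator_def)
    also have "\<dots> = ennreal ((a i)\<^sup>2)"
      using finV x by (simp add: i_def V_def)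
    finally show "(\<Sum>j\<in>I. ennreal ((a j)\<^sup>2) * indicator (A j) x) = ennreal ((s x - indicator D x)\<^sup>2)"
      by (simp add: a_def i_def indicator_def of_bool_def)
  qed
  finally show ?thesis .
qed

text \<open>The choice in \<open>gaussian_integral\<close> leaves the version open, so the chosen
  one is compared with \<open>G D\<close> along its own approximating sequence \<open>s n\<close>.
  The integrals of \<open>s n\<close> converge in mean square to the chosen version by definition,
  and to \<open>G D\<close> by the isometry.\<close>

lemma gaussian_integral_indicator:
  assumes D: "D \<in> sets \<nu>" "emeasure \<nu> D < \<infinity>"
    and g: "\<And>x. x \<in> space \<nu> \<Longrightarrow> g x = indicator D x"
  shows "gaussian_integral M \<nu> G g \<in> borel_measurable M"
    and "AE w in M. gaussian_integral M \<nu> G g w = G D w"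
proof -
  note [measurable] = D(1) grm_measurable[OF D]
  have gm: "g \<in> borel_measurable \<nu>"
    using g by (subst measurable_cong[where g="indicator D"]) auto
  have "{x \<in> space \<nu>. indicator D x \<noteq> (0::real)} = D"
    using sets.sets_into_space[OF D(1)] by (auto simp: indicator_def)
  then have ind: "simple_function \<nu> (indicator D :: 'b \<Rightarrow> real)"
    "emeasure \<nu> {x \<in> space \<nu>. indicator D x \<noteq> (0::real)} < \<infinity>"
    using D by auto
  \<comment> \<open>The constant sequence \<open>indicator D\<close> shows that \<open>G D\<close>
    is an integral of \<open>g\<close>. One therefore exists, and the choice operator picks a
    genuine integral.\<close>
  have "(\<integral>\<^sup>+x. ennreal ((indicator D x - g x)\<^sup>2) \<partial>\<nu>) = 0"
    using g by (simp cong: nn_integral_cong_simp)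
  moreover have "(\<integral>\<^sup>+w. ennreal ((simple_gaussian_integral \<nu> G (indicator D) w - G D w)\<^sup>2) \<partial>M) = 0"
    using simple_gaussian_integral_isometry[OF ind D] by simp
  ultimately have "has_gaussian_integral M \<nu> G g (G D)"
    unfolding has_gaussian_integral_def using gm ind
    by (intro conjI exI[of _ "\<lambda>_. indicator D"]) auto
  then have I: "has_gaussian_integral M \<nu> G g (gaussian_integral M \<nu> G g)" (is "has_gaussian_integral _ _ _ _ ?I")
    unfolding gaussian_integral_def by (rule someI[of "has_gaussian_integral M \<nu> G g"])
  then show [measurable]: "?I \<in> borel_measurable M"
    by (simp add: has_gaussian_integral_def)
  from I obtain s where s: "\<And>n. simple_function \<nu> (s n)" "\<And>n. emeasure \<nu> {x \<in> space \<nu>. s n x \<noteq> 0} < \<infinity>"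
    and lim1: "(\<lambda>n. \<integral>\<^sup>+x. ennreal ((s n x - g x)\<^sup>2) \<partial>\<nu>) \<longlonglongrightarrow> 0"
    and lim2: "(\<lambda>n. \<integral>\<^sup>+w. ennreal ((simple_gaussian_integral \<nu> G (s n) w - ?I w)\<^sup>2) \<partial>M) \<longlonglongrightarrow> 0"
    unfolding has_gaussian_integral_def by blast
  note [measurable] = simple_gaussian_integral_measurable[OF s]
  have "(\<integral>\<^sup>+w. ennreal ((?I w - G D w)\<^sup>2) \<partial>M) \<le>
      2 * ((\<integral>\<^sup>+w. ennreal ((simple_gaussian_integral \<nu> G (s n) w - ?I w)\<^sup>2) \<partial>M) +
        (\<integral>\<^sup>+x. ennreal ((s n x - g x)\<^sup>2) \<partial>\<nu>))" for n
  proof -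
    \<comment> \<open>Right side minus left side is the square of
      \<open>2 * a - b - c\<close>.\<close>
    have sq: "(b - c)\<^sup>2 \<le> 2 * ((a - b)\<^sup>2 + (a - c)\<^sup>2)" for a b c :: real
      using zero_le_power2[of "2 * a - b - c"] by (simp add: power2_eq_square algebra_simps)
    let ?S = "simple_gaussian_integral \<nu> G (s n)"
    have "(\<integral>\<^sup>+w. ennreal ((?I w - G D w)\<^sup>2) \<partial>M) \<le>
        (\<integral>\<^sup>+w. 2 * (ennreal ((?S w - ?I w)\<^sup>2) + ennreal ((?S w - G D w)\<^sup>2)) \<partial>M)"
    proof (rule nn_integral_mono)
      fix w
      have "ennreal ((?I w - G D w)\<^sup>2) \<le> ennreal (2 * ((?S w - ?I w)\<^sup>2 + (?S w - G D w)\<^sup>2))"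
        by (intro ennreal_leI sq)
      then show "ennreal ((?I w - G D w)\<^sup>2) \<le> 2 * (ennreal ((?S w - ?I w)\<^sup>2) + ennreal ((?S w - G D w)\<^sup>2))"
        by (simp add: ennreal_mult)
    qed
    also have "\<dots> = 2 * ((\<integral>\<^sup>+w. ennreal ((?S w - ?I w)\<^sup>2) \<partial>M) + (\<integral>\<^sup>+w. ennreal ((?S w - G D w)\<^sup>2) \<partial>M))"
      by (subst nn_integral_cmult, measurable) (subst nn_integral_add, auto)
    also have "(\<integral>\<^sup>+w. ennreal ((?S w - G D w)\<^sup>2) \<partial>M) = (\<integral>\<^sup>+x. ennreal ((s n x - g x)\<^sup>2) \<partial>\<nu>)"
      unfolding simple_gaussian_integral_isometry[OF s D] using g by (intro nn_integral_cong) simp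
    finally show ?thesis .
  qed
  moreover have "(\<lambda>n. 2 * ((\<integral>\<^sup>+w. ennreal ((simple_gaussian_integral \<nu> G (s n) w - ?I w)\<^sup>2) \<partial>M) +
      (\<integral>\<^sup>+x. ennreal ((s n x - g x)\<^sup>2) \<partial>\<nu>))) \<longlonglongrightarrow> 2 * (0 + 0)"
    by (intro ennreal_tendsto_cmult tendsto_add lim1 lim2) simp
  ultimately have "(\<integral>\<^sup>+w. ennreal ((?I w - G D w)\<^sup>2) \<partial>M) \<le> 0"
    by (intro LIMSEQ_le_const) auto
  then have "AE w in M. ennreal ((?I w - G D w)\<^sup>2) = 0"
    by (simp add: nn_integral_0_iff_AE)
  then show "AE w in M. ?I w = G D w"
    by eventually_elim simp
qed

end

section \<open>Independent increments\<close>

text \<open>Independence of a nonempty family says that its joint law is the product of its marginal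
  laws, and neither changes under almost sure modification. Finiteness lets one null set cover all
  indices.\<close>

lemma (in prob_space) indep_vars_cong_AE:
  assumes X: "indep_vars N X I" and Y: "\<And>i. i \<in> I \<Longrightarrow> Y i \<in> measurable M (N i)"
    and eq: "\<And>i. i \<in> I \<Longrightarrow> AE w in M. X i w = Y i w" and I: "finite I"
  shows "indep_vars N Y I"
proof (cases "I = {}")
  case True
  then show ?thesis by (simp add: indep_vars_def indep_sets_def)
next
  case False
  have Xm: "X i \<in> measurable M (N i)" if "i \<in> I" for i
    using X that by (simp add: indep_vars_def)
  have "AE w in M. \<forall>i\<in>I. X i w = Y i w"
    using eq I by (simp add: AE_finite_all)
  then have "distr M (PiM I N) (\<lambda>w. \<lambda>i\<in>I. Y i w) = distr M (PiM I N) (\<lambda>w. \<lambda>i\<in>I. X i w)"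
    using Xm Y by (intro distr_cong_AE measurable_restrict) (auto simp: fun_eq_iff restrict_def)
  also have "\<dots> = (\<Pi>\<^sub>M i\<in>I. distr M (N i) (X i))"
    using X False Xm by (simp add: indep_vars_iff_distr_eq_PiM')
  also have "\<dots> = (\<Pi>\<^sub>M i\<in>I. distr M (N i) (Y i))"
    using eq Xm Y by (intro PiM_cong refl distr_cong_AE) auto
  finally show ?thesis
    using False Y by (simp add: indep_vars_iff_distr_eq_PiM')
qed

text \<open>The sorted list of \<open>J\<close>, continued by its last entry. All of
  \<open>J\<close> is exhausted below \<open>n\<close>, so the index \<open>n\<close> repeats the
  maximum: this keeps \<open>n\<close> positive even for a singleton, at the price of one degenerate
  last increment.\<close>

lemma mono_enumeration:
  fixes J :: "'a::linorder set"
  assumes "finite J" "J \<noteq> {}"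
  obtains n :: nat and \<tau> :: "nat \<Rightarrow> 'a" where "n > 0" "\<tau> 0 = Min J" "mono_on {..n} \<tau>" "range \<tau> \<subseteq> J" "J \<subseteq> \<tau> ` {..<n}"
proof -
  let ?xs = "sorted_list_of_set J"
  let ?n = "card J"
  let ?\<tau> = "\<lambda>i. ?xs ! min i (?n - 1)"
  have n: "?n > 0" using assms by (simp add: card_gt_0_iff)
  have "?xs \<noteq> []" using assms by simp
  then have \<tau>0: "?\<tau> 0 = Min J"
    using assms by (simp add: hd_conv_nth[symmetric] sorted_list_of_set_nonempty)
  have mono: "mono_on {..?n} ?\<tau>"
    using n by (intro mono_onI sorted_nth_mono) auto
  have mem: "?xs ! i \<in> J" if "i < ?n" for i
    using nth_mem[of i ?xs] that assms by simp
  have ran: "range ?\<tau> \<subseteq> J"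
    using n by (auto intro!: mem)
  have sub: "J \<subseteq> ?\<tau> ` {..<?n}"
  proof
    fix x assume "x \<in> J"
    then have "x \<in> set ?xs" using assms by simp
    then obtain i where "i < ?n" "?xs ! i = x"
      by (auto simp: in_set_conv_nth)
    then show "x \<in> ?\<tau> ` {..<?n}"
      by (intro image_eqI[of _ _ i]) auto
  qed
  show ?thesis
    using n \<tau>0 mono ran sub by (rule that)
qed

text \<open>By telescoping, \<open>X t\<close> is \<open>X (\<tau> 0)\<close>, almost surely zero,
  plus the increments up to \<open>t\<close>. The vector is thus the image of independent increments
  under a partial-sum map, and its law depends on \<open>X\<close> only through the laws of the
  single increments.\<close>

lemma distr_from_increments:
  fixes X :: "real \<Rightarrow> 'w \<Rightarrow> real"
  assumes M: "prob_space M" and J: "finite J" and n: "n > 0"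
    and X: "\<And>i. X (\<tau> i) \<in> borel_measurable M"
    and X0: "AE w in M. X (\<tau> 0) w = 0"
    and ind: "prob_space.indep_vars M (\<lambda>_. borel) (\<lambda>i w. X (\<tau> (Suc i)) w - X (\<tau> i) w) {..<n}"
    and idx: "\<And>t. t \<in> J \<Longrightarrow> idx t < n" "\<And>t. t \<in> J \<Longrightarrow> \<tau> (idx t) = t"
  shows "distr M (\<Pi>\<^sub>M t\<in>J. borel) (\<lambda>w. \<lambda>t\<in>J. X t w) =
    distr (\<Pi>\<^sub>M i\<in>{..<n}. distr M borel (\<lambda>w. X (\<tau> (Suc i)) w - X (\<tau> i) w))
      (\<Pi>\<^sub>M t\<in>J. borel) (\<lambda>v. \<lambda>t\<in>J. \<Sum>i<idx t. v i)"
proof -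
  interpret prob_space M by (rule M)
  note [measurable] = X
  let ?D = "\<lambda>i w. X (\<tau> (Suc i)) w - X (\<tau> i) w"
  have [measurable]: "(\<lambda>w. \<lambda>i\<in>{..<n}. ?D i w) \<in> measurable M (\<Pi>\<^sub>M i\<in>{..<n}. borel)"
    by (intro measurable_restrict) measurable
  have S: "(\<lambda>v. \<lambda>t\<in>J. \<Sum>i<idx t. v i) \<in> measurable (\<Pi>\<^sub>M i\<in>{..<n}. borel) (\<Pi>\<^sub>M t\<in>J. (borel :: real measure))"
  proof (intro measurable_restrict borel_measurable_sum)
    fix t i assume "t \<in> J" "i \<in> {..<idx t}"
    then have "i \<in> {..<n}" using idx(1)[of t] by simp
    then show "(\<lambda>v. v i) \<in> measurable (\<Pi>\<^sub>M i\<in>{..<n}. borel) (borel :: real measure)"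
      by (rule measurable_component_singleton)
  qed
  have tel: "X t w = X (\<tau> 0) w + (\<Sum>i<idx t. ?D i w)" if "t \<in> J" for t w
    using sum_lessThan_telescope[of "\<lambda>i. X (\<tau> i) w" "idx t"] idx(2)[OF that] by simp
  have Xt: "X t \<in> borel_measurable M" if "t \<in> J" for t
    using X[of "idx t"] idx(2)[OF that] by simp
  have "distr M (\<Pi>\<^sub>M t\<in>J. borel) (\<lambda>w. \<lambda>t\<in>J. X t w) =
      distr M (\<Pi>\<^sub>M t\<in>J. borel) ((\<lambda>v. \<lambda>t\<in>J. \<Sum>i<idx t. v i) \<circ> (\<lambda>w. \<lambda>i\<in>{..<n}. ?D i w))"
  proof (rule distr_cong_AE)
    show "AE w in M. (\<lambda>t\<in>J. X t w) = ((\<lambda>v. \<lambda>t\<in>J. \<Sum>i<idx t. v i) \<circ> (\<lambda>w. \<lambda>i\<in>{..<n}. ?D i w)) w"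
      using X0
    proof eventually_elim
      case (elim w)
      have "X t w = (\<Sum>i<idx t. restrict (\<lambda>i. ?D i w) {..<n} i)" if "t \<in> J" for t
        unfolding tel[OF that] using elim idx(1)[OF that] by (auto intro!: sum.cong)
      then show ?case by auto
    qed
  qed (auto intro!: measurable_restrict Xt measurable_comp[OF _ S])
  also have "\<dots> = distr (distr M (\<Pi>\<^sub>M i\<in>{..<n}. borel) (\<lambda>w. \<lambda>i\<in>{..<n}. ?D i w))
      (\<Pi>\<^sub>M t\<in>J. borel) (\<lambda>v. \<lambda>t\<in>J. \<Sum>i<idx t. v i)"
    by (rule distr_distr[symmetric, OF S]) measurable
  \<comment> \<open>Positivity of \<open>n\<close> makes the index set nonempty, as the product
    characterisation of independence requires.\<close>
  also have "distr M (\<Pi>\<^sub>M i\<in>{..<n}. borel) (\<lambda>w. \<lambda>i\<in>{..<n}. ?D i w) =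
      (\<Pi>\<^sub>M i\<in>{..<n}. distr M borel (?D i))"
    using ind n by (subst (asm) indep_vars_iff_distr_eq_PiM') auto
  finally show ?thesis .
qed

text \<open>Both vectors have the image of the same product of increment laws under the same
  partial-sum map as their law.\<close>

lemma fdd_eq_independent_increments:
  fixes X :: "real \<Rightarrow> 'w \<Rightarrow> real" and Y :: "real \<Rightarrow> 'v \<Rightarrow> real"
  assumes M: "prob_space M" and N: "prob_space N"
    and X: "\<And>t. 0 \<le> t \<Longrightarrow> X t \<in> borel_measurable M" and Y: "\<And>t. 0 \<le> t \<Longrightarrow> Y t \<in> borel_measurable N"
    and X0: "AE w in M. X 0 w = 0" and Y0: "AE w in N. Y 0 w = 0"
    and law: "\<And>s t. 0 \<le> s \<Longrightarrow> s \<le> t \<Longrightarrow>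
      distr M borel (\<lambda>w. X t w - X s w) = distr N borel (\<lambda>w. Y t w - Y s w)"
    and Xind: "\<And>\<tau> n. 0 \<le> \<tau> 0 \<Longrightarrow> mono_on {..n} \<tau> \<Longrightarrow>
      prob_space.indep_vars M (\<lambda>_. borel) (\<lambda>i w. X (\<tau> (Suc i)) w - X (\<tau> i) w) {..<n}"
    and Yind: "\<And>\<tau> n. 0 \<le> \<tau> 0 \<Longrightarrow> mono_on {..n} \<tau> \<Longrightarrow>
      prob_space.indep_vars N (\<lambda>_. borel) (\<lambda>i w. Y (\<tau> (Suc i)) w - Y (\<tau> i) w) {..<n}"
  shows "fdd_eq M N {0..} X Y"
  unfolding fdd_eq_def
proof (intro conjI allI impI)
  show "\<forall>t\<in>{0..}. X t \<in> borel_measurable M \<and> Y t \<in> borel_measurable N"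
    using X Y by simp
next
  fix J :: "real set" assume J: "finite J \<and> J \<subseteq> {0..}"
  \<comment> \<open>Adjoining 0 makes the time grid start where both processes vanish, and keeps it
    nonempty when \<open>J\<close> is empty.\<close>
  then have J': "finite (insert 0 J)" "insert 0 J \<noteq> {}" "Min (insert 0 J) = 0"
    by (auto intro!: Min_eqI)
  obtain n :: nat and \<tau> :: "nat \<Rightarrow> real" where n: "n > 0" and "\<tau> 0 = Min (insert 0 J)" and mono: "mono_on {..n} \<tau>"
    and "range \<tau> \<subseteq> insert 0 J" and sub: "insert 0 J \<subseteq> \<tau> ` {..<n}"
    by (rule mono_enumeration[OF J'(1,2)])
  then have \<tau>0: "\<tau> 0 = 0" using J'(3) by simp
  have nonneg: "0 \<le> \<tau> i" for i
  proof -
    have "\<tau> i \<in> insert 0 J"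
      using \<open>range \<tau> \<subseteq> insert 0 J\<close> by blast
    then show ?thesis using J by auto
  qed
  have "\<exists>i<n. \<tau> i = t" if "t \<in> J" for t
    using sub that by (auto simp: subset_iff)
  then obtain idx where idx: "\<And>t. t \<in> J \<Longrightarrow> idx t < n" "\<And>t. t \<in> J \<Longrightarrow> \<tau> (idx t) = t"
    by metis
  have law': "distr M borel (\<lambda>w. X (\<tau> (Suc i)) w - X (\<tau> i) w) = distr N borel (\<lambda>w. Y (\<tau> (Suc i)) w - Y (\<tau> i) w)"
    if "i < n" for i
    using nonneg mono that by (intro law) (auto simp: mono_on_def)
  have "distr M (\<Pi>\<^sub>M t\<in>J. borel) (\<lambda>w. \<lambda>t\<in>J. X t w) =
    distr (\<Pi>\<^sub>M i\<in>{..<n}. distr M borel (\<lambda>w. X (\<tau> (Suc i)) w - X (\<tau> i) w))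
      (\<Pi>\<^sub>M t\<in>J. borel) (\<lambda>v. \<lambda>t\<in>J. \<Sum>i<idx t. v i)"
    using J X0 \<tau>0 by (intro distr_from_increments M n X nonneg Xind mono idx) auto
  also have "(\<Pi>\<^sub>M i\<in>{..<n}. distr M borel (\<lambda>w. X (\<tau> (Suc i)) w - X (\<tau> i) w)) =
      (\<Pi>\<^sub>M i\<in>{..<n}. distr N borel (\<lambda>w. Y (\<tau> (Suc i)) w - Y (\<tau> i) w))"
    by (intro PiM_cong refl law') simp
  also have "distr \<dots> (\<Pi>\<^sub>M t\<in>J. borel) (\<lambda>v. \<lambda>t\<in>J. \<Sum>i<idx t. v i) =
      distr N (\<Pi>\<^sub>M t\<in>J. borel) (\<lambda>w. \<lambda>t\<in>J. Y t w)"
    using J Y0 \<tau>0 by (intro distr_from_increments[symmetric] N n Y nonneg Yind mono idx) auto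
  finally show "distr M (\<Pi>\<^sub>M t\<in>J. borel) (\<lambda>w. \<lambda>t\<in>J. X t w) = distr N (\<Pi>\<^sub>M t\<in>J. borel) (\<lambda>w. \<lambda>t\<in>J. Y t w)" .
qed

section \<open>The sets \<open>D\<^sub>t\<close>\<close>

lemma emeasure_lborel_scaleR_vimage:
  fixes A :: "'a::euclidean_space set"
  assumes A: "A \<in> sets borel" and "0 < t"
  shows "emeasure lborel A = ennreal (t ^ DIM('a)) * emeasure lborel ((\<lambda>x. t *\<^sub>R x) -` A)"
proof -
  have "emeasure lborel A =
      emeasure (density (distr lborel borel (\<lambda>x. 0 + t *\<^sub>R x)) (\<lambda>_. \<bar>t\<bar> ^ DIM('a))) A"
    using \<open>0 < t\<close> by (subst lborel_affine[of t 0]) auto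
  also have "\<dots> = ennreal (t ^ DIM('a)) * emeasure (distr lborel borel (\<lambda>x. t *\<^sub>R x)) A"
    using A \<open>0 < t\<close> by (subst emeasure_density_const) auto
  also have "emeasure (distr lborel borel (\<lambda>x. t *\<^sub>R x)) A = emeasure lborel ((\<lambda>x. t *\<^sub>R x) -` A)"
    using A by (subst emeasure_distr) auto
  finally show ?thesis .
qed

text \<open>The product measure is determined by its values on boxes. There the dilation acts
  coordinatewise, and each of the \<open>card I\<close> factors contributes
  \<open>t ^ DIM('a)\<close>.\<close>

lemma emeasure_PiM_lborel_scaleR_vimage:
  fixes A :: "('i \<Rightarrow> 'a::euclidean_space) set"
  assumes I: "finite I" and A: "A \<in> sets (\<Pi>\<^sub>M i\<in>I. lborel)" and t: "0 < t"
  shows "emeasure (\<Pi>\<^sub>M i\<in>I. lborel) A = ennreal (t ^ (DIM('a) * card I)) *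
    emeasure (\<Pi>\<^sub>M i\<in>I. lborel) ((\<lambda>y. \<lambda>i\<in>I. t *\<^sub>R y i) -` A \<inter> space (\<Pi>\<^sub>M i\<in>I. lborel))"
proof -
  interpret product_sigma_finite "\<lambda>_::'i. lborel :: 'a measure" ..
  let ?P = "\<Pi>\<^sub>M i\<in>I. (lborel :: 'a measure)" and ?T = "\<lambda>y. \<lambda>i\<in>I. t *\<^sub>R y i"
  let ?c = "ennreal (t ^ (DIM('a) * card I))"
  have comp: "(\<lambda>y. y i) \<in> borel_measurable ?P" if "i \<in> I" for i
    using measurable_component_singleton[OF that, of "\<lambda>_. lborel :: 'a measure"] by simp
  have T: "?T \<in> measurable ?P ?P"
    by (rule measurable_restrict) (auto intro!: borel_measurable_scaleR comp)
  have "scale_measure ?c (distr ?P ?P ?T) = ?P"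
  proof (rule PiM_eqI[OF I])
    fix B :: "'i \<Rightarrow> 'a set" assume "\<And>i. i \<in> I \<Longrightarrow> B i \<in> sets lborel"
    then have B: "\<And>i. i \<in> I \<Longrightarrow> B i \<in> sets borel" by simp
    have vB: "(\<lambda>x. t *\<^sub>R x) -` B i \<in> sets borel" if "i \<in> I" for i
      using measurable_sets[of "\<lambda>x. t *\<^sub>R x" borel borel "B i"] B[OF that] by simp
    have pre: "?T -` (Pi\<^sub>E I B) \<inter> space ?P = (\<Pi>\<^sub>E i\<in>I. (\<lambda>x. t *\<^sub>R x) -` B i)"
      by (auto simp: space_PiM PiE_iff)
    have "emeasure (scale_measure ?c (distr ?P ?P ?T)) (Pi\<^sub>E I B) =
        ?c * emeasure ?P (\<Pi>\<^sub>E i\<in>I. (\<lambda>x. t *\<^sub>R x) -` B i)"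
      using I B by (simp add: emeasure_distr[OF T] pre sets_PiM_I_finite)
    also have "\<dots> = (\<Prod>i\<in>I. ennreal (t ^ DIM('a)) * emeasure lborel ((\<lambda>x. t *\<^sub>R x) -` B i))"
      using I vB t by (simp add: emeasure_PiM prod.distrib power_mult ennreal_power)
    also have "\<dots> = (\<Prod>i\<in>I. emeasure lborel (B i))"
      using B t by (intro prod.cong refl emeasure_lborel_scaleR_vimage[symmetric])
    finally show "emeasure (scale_measure ?c (distr ?P ?P ?T)) (Pi\<^sub>E I B) = (\<Prod>i\<in>I. emeasure lborel (B i))" .
  qed simp
  then have "emeasure ?P A = emeasure (scale_measure ?c (distr ?P ?P ?T)) A" by simp
  also have "\<dots> = ?c * emeasure ?P (?T -` A \<inter> space ?P)"
    using A by (simp add: emeasure_distr[OF T])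
  finally show ?thesis .
qed

section \<open>Configurations of balls with a common point\<close>

text \<open>The common building block of both signs: \<open>h_minus\<close> takes the full index set
  for \<open>S\<close>, \<open>h_plus\<close> all index sets with one index removed.\<close>

definition ball_meet :: "nat \<Rightarrow> nat set \<Rightarrow> real \<Rightarrow> (nat \<Rightarrow> real ^ 'd) set" where
  "ball_meet k S t = {y \<in> space (m_k k). (\<Inter>j\<in>S. ball (cons0 y j) (t / 2)) \<noteq> {}}"

lemma D_set_h_minus: "D_set k (h_minus k) t = ball_meet k {1..k+2} t"
  by (auto simp: D_set_def h_minus_def ball_meet_def)

lemma D_set_h_plus:
  "D_set k (h_plus k) t = {y \<in> space (m_k k). \<forall>i\<in>{1..k+2}. y \<in> ball_meet k ({1..k+2} - {i}) t}"
proof -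
  \<comment> \<open>This turns the product in \<open>h_plus\<close> into a bounded
    quantifier.\<close>
  have "prod (\<lambda>i. of_bool (P i)) A = (1::real) \<longleftrightarrow> (\<forall>i\<in>A. P i)" if "finite A" for P and A :: "nat set"
    using that by induction auto
  note prod_eq_1 = this[OF finite_atLeastAtMost]
  show ?thesis
    unfolding D_set_def h_plus_def prod_eq_1 by (auto simp only: ball_meet_def)
qed

text \<open>Both kernels take only the values 0 and 1. This reduces the stochastic integral to that
  of an indicator.\<close>

lemma h_eq_indicator:
  assumes "h \<in> {h_plus k, h_minus k}" "y \<in> space (m_k k)"
  shows "h t (cons0 y) = indicator (D_set k h t) y"
proof -
  have "prod (\<lambda>i. of_bool (P i)) A \<in> {0, 1::real}" if "finite A" for P and A :: "nat set"
    using that by induction auto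
  note prod_of_bool = this[OF finite_atLeastAtMost]
  from assms(1) have "h t (cons0 y) \<in> {0, 1}"
  proof (elim insertE emptyE)
    assume "h = h_plus k"
    then show ?thesis by (simp only: h_plus_def prod_of_bool)
  qed (simp add: h_minus_def)
  then show ?thesis
    using assms(2) by (cases "h t (cons0 y) = 1") (simp_all add: D_set_def)
qed

lemma measurable_cons0:
  assumes "j \<in> {1..k+2}"
  shows "(\<lambda>y. cons0 y j) \<in> borel_measurable (m_k k)"
proof (cases "j = 1")
  case False
  then have "j - 1 \<in> {1..k+1}" using assms by auto
  then have "(\<lambda>y. y (j - 1)) \<in> measurable (m_k k) lborel"
    unfolding m_k_def by (rule measurable_component_singleton)
  with False show ?thesis by (simp add: cons0_def)
qed (simp add: cons0_def)

text \<open>A finite intersection of open balls is open, so if it is nonempty it contains a point of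
  a countable dense set. The union over all candidate common points thus reduces to a countable
  one.\<close>

lemma sets_ball_meet:
  assumes "S \<subseteq> {1..k+2}"
  shows "ball_meet k S t \<in> sets (m_k k :: (nat \<Rightarrow> real ^ 'd) measure)"
proof -
  obtain Q :: "(real ^ 'd) set" where Q: "countable Q" "\<And>X. open X \<Longrightarrow> X \<noteq> {} \<Longrightarrow> \<exists>d\<in>Q. d \<in> X"
    using countable_dense_exists by blast
  have fin: "finite S" using assms finite_subset by blast
  have "ball_meet k S t = (\<Union>z\<in>Q. {y \<in> space (m_k k). \<forall>j\<in>S. dist (cons0 y j) z < t / 2})"
  proof (intro equalityI subsetI)
    fix y :: "nat \<Rightarrow> real ^ 'd" assume y: "y \<in> ball_meet k S t"
    have "open (\<Inter>j\<in>S. ball (cons0 y j) (t / 2))"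
      using fin by (intro open_INT) auto
    with y Q(2) obtain z where "z \<in> Q" "z \<in> (\<Inter>j\<in>S. ball (cons0 y j) (t / 2))"
      unfolding ball_meet_def by blast
    with y show "y \<in> (\<Union>z\<in>Q. {y \<in> space (m_k k). \<forall>j\<in>S. dist (cons0 y j) z < t / 2})"
      by (auto simp: ball_meet_def)
  next
    fix y :: "nat \<Rightarrow> real ^ 'd"
    assume "y \<in> (\<Union>z\<in>Q. {y \<in> space (m_k k). \<forall>j\<in>S. dist (cons0 y j) z < t / 2})"
    then obtain z where "y \<in> space (m_k k)" "\<forall>j\<in>S. dist (cons0 y j) z < t / 2" by auto
    then have "y \<in> space (m_k k)" "z \<in> (\<Inter>j\<in>S. ball (cons0 y j) (t / 2))" by auto
    then show "y \<in> ball_meet k S t" unfolding ball_meet_def by blast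
  qed
  also have "\<dots> \<in> sets (m_k k)"
  proof (intro sets.countable_UN'' Q(1) sets.sets_Collect_finite_All fin)
    fix z :: "real ^ 'd" and j assume "j \<in> S"
    then have [measurable]: "(\<lambda>y. cons0 y j :: real ^ 'd) \<in> borel_measurable (m_k k)"
      using assms by (intro measurable_cons0) auto
    show "{y \<in> space (m_k k). dist (cons0 y j) z < t / 2} \<in> sets (m_k k)" by measurable
  qed
  finally show ?thesis .
qed

lemma ball_meet_mono:
  "s \<le> t \<Longrightarrow> ball_meet k S s \<subseteq> (ball_meet k S t :: (nat \<Rightarrow> real ^ 'd) set)"
proof
  fix y :: "nat \<Rightarrow> real ^ 'd" assume "s \<le> t" "y \<in> ball_meet k S s"
  moreover from \<open>s \<le> t\<close> have "(\<Inter>j\<in>S. ball (cons0 y j) (s / 2)) \<subseteq> (\<Inter>j\<in>S. ball (cons0 y j) (t / 2))"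
    by (intro INF_superset_mono subset_refl subset_ball) auto
  ultimately show "y \<in> ball_meet k S t"
    unfolding ball_meet_def by blast
qed

lemma cons0_scaleR:
  assumes "j \<in> {1..k+2}"
  shows "cons0 (\<lambda>i\<in>{1..k+1}. t *\<^sub>R y i) j = t *\<^sub>R cons0 y j"
  using assms by (auto simp: cons0_def)

text \<open>Dilation by \<open>t\<close> carries balls of radius \<open>1 / 2\<close> to balls of
  radius \<open>t / 2\<close>, hence common points to common points, and it fixes the origin that
  \<open>cons0\<close> puts first.\<close>

lemma ball_meet_scaleR:
  fixes y :: "nat \<Rightarrow> real ^ 'd"
  assumes S: "S \<subseteq> {1..k+2}" and t: "0 < t" and y: "y \<in> space (m_k k)"
  shows "(\<lambda>i\<in>{1..k+1}. t *\<^sub>R y i) \<in> ball_meet k S t \<longleftrightarrow> y \<in> ball_meet k S 1"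
proof -
  have d: "dist (t *\<^sub>R a) (t *\<^sub>R b) < t / 2 \<longleftrightarrow> dist a b < 1 / 2" for a b :: "real ^ 'd"
  proof -
    have "dist (t *\<^sub>R a) (t *\<^sub>R b) = t * dist a b"
      using t by (simp add: dist_norm flip: scaleR_diff_right)
    then show ?thesis
      using mult_less_cancel_left_pos[OF t, of "dist a b" "1 / 2"] by simp
  qed
  have eq: "(\<Inter>j\<in>S. ball (cons0 (\<lambda>i\<in>{1..k+1}. t *\<^sub>R y i) j) (t / 2)) = (\<Inter>j\<in>S. ball (t *\<^sub>R cons0 y j) (t / 2))"
    using S by (intro INF_cong refl) (simp only: cons0_scaleR subset_iff)
  have "(\<Inter>j\<in>S. ball (t *\<^sub>R cons0 y j) (t / 2)) \<noteq> {} \<longleftrightarrow> (\<Inter>j\<in>S. ball (cons0 y j) (1 / 2)) \<noteq> {}"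
  proof
    assume "(\<Inter>j\<in>S. ball (t *\<^sub>R cons0 y j) (t / 2)) \<noteq> {}"
    then obtain z where z: "\<forall>j\<in>S. dist (t *\<^sub>R cons0 y j) z < t / 2" by auto
    have "t *\<^sub>R ((1 / t) *\<^sub>R z) = z" using t by simp
    with z have "\<forall>j\<in>S. dist (cons0 y j) ((1 / t) *\<^sub>R z) < 1 / 2" using d by metis
    then have "(1 / t) *\<^sub>R z \<in> (\<Inter>j\<in>S. ball (cons0 y j) (1 / 2))" by simp
    then show "(\<Inter>j\<in>S. ball (cons0 y j) (1 / 2)) \<noteq> {}" by blast
  next
    assume "(\<Inter>j\<in>S. ball (cons0 y j) (1 / 2)) \<noteq> {}"
    then obtain z where "\<forall>j\<in>S. dist (cons0 y j) z < 1 / 2" by auto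
    then have "t *\<^sub>R z \<in> (\<Inter>j\<in>S. ball (t *\<^sub>R cons0 y j) (t / 2))" by (simp only: INT_iff mem_ball d)
    then show "(\<Inter>j\<in>S. ball (t *\<^sub>R cons0 y j) (t / 2)) \<noteq> {}" by blast
  qed
  moreover have "(\<lambda>i\<in>{1..k+1}. t *\<^sub>R y i) \<in> space (m_k k)"
    by (simp add: m_k_def space_PiM)
  ultimately show ?thesis
    using y by (simp only: ball_meet_def eq mem_Collect_eq simp_thms)
qed

text \<open>A common point is within \<open>t / 2\<close> both of the origin, entry 1 of
  \<open>cons0 y\<close>, and of \<open>y i\<close>, which the shift makes entry
  \<open>Suc i\<close>; the triangle inequality does the rest.\<close>

lemma ball_meet_bound:
  fixes y :: "nat \<Rightarrow> real ^ 'd"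
  assumes "y \<in> ball_meet k S t" "1 \<in> S" "Suc i \<in> S" "i \<noteq> 0"
  shows "y i \<in> ball 0 t"
proof -
  from assms(1) obtain z where z: "z \<in> (\<Inter>j\<in>S. ball (cons0 y j) (t / 2))"
    by (auto simp: ball_meet_def)
  have "dist (0::real ^ 'd) z < t / 2" "dist (y i) z < t / 2"
    using z assms by (auto simp: cons0_def dest: INT_D[of z _ _ 1] INT_D[of z _ _ "Suc i"])
  then show ?thesis
    using dist_triangle[of 0 "y i" z] by (simp add: dist_commute)
qed

section \<open>Properties of \<open>D_set\<close> shared by both signs\<close>

context
  fixes k :: nat and h :: "real \<Rightarrow> (nat \<Rightarrow> real ^ 'd) \<Rightarrow> real"
  assumes h: "h \<in> {h_plus k, h_minus k}"
begin

lemma sets_D_set: "D_set k h t \<in> sets (m_k k)"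
proof -
  have "D_set k (h_plus k) t \<in> sets (m_k k :: (nat \<Rightarrow> real ^ 'd) measure)"
  proof -
    have *: "{y \<in> space (m_k k). y \<in> ball_meet k S t} = (ball_meet k S t :: (nat \<Rightarrow> real ^ 'd) set)" for S
      by (auto simp: ball_meet_def)
    have "{y \<in> space (m_k k). \<forall>i\<in>{1..k+2}. y \<in> ball_meet k ({1..k+2} - {i}) t} \<in>
        sets (m_k k :: (nat \<Rightarrow> real ^ 'd) measure)"
      by (intro sets.sets_Collect_finite_All finite_atLeastAtMost, unfold *) (intro sets_ball_meet Diff_subset)
    then show ?thesis unfolding D_set_h_plus .
  qed
  moreover have "D_set k (h_minus k) t \<in> sets (m_k k :: (nat \<Rightarrow> real ^ 'd) measure)"
    unfolding D_set_h_minus by (rule sets_ball_meet) simp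
  ultimately show ?thesis using h by auto
qed

lemma D_set_mono:
  assumes "s \<le> t"
  shows "D_set k h s \<subseteq> D_set k h t"
proof -
  note mono = subsetD[OF ball_meet_mono[OF assms]]
  from h show ?thesis
    by (elim insertE emptyE) (auto simp only: D_set_h_plus D_set_h_minus mem_Collect_eq intro: mono)
qed

lemma D_set_scaleR:
  assumes "0 < t" "y \<in> space (m_k k)"
  shows "(\<lambda>i\<in>{1..k+1}. t *\<^sub>R y i) \<in> D_set k h t \<longleftrightarrow> y \<in> D_set k h 1"
proof -
  have sp: "(\<lambda>i\<in>{1..k+1}. t *\<^sub>R y i) \<in> space (m_k k)"
    by (simp add: m_k_def space_PiM)
  from h show ?thesis
  proof (elim insertE emptyE)
    assume "h = h_plus k"
    then show ?thesis
      unfolding D_set_h_plus using sp assms ball_meet_scaleR[OF _ assms]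
      by (simp only: D_set_h_plus mem_Collect_eq Diff_subset)
  next
    assume "h = h_minus k"
    then show ?thesis
      using ball_meet_scaleR[OF subset_refl assms] by (simp only: D_set_h_minus)
  qed
qed

lemma D_set_bounded:
  assumes "1 \<le> k"
  shows "D_set k h t \<subseteq> (\<Pi>\<^sub>E i\<in>{1..k+1}. ball 0 t)"
proof
  fix y assume y: "y \<in> D_set k h t"
  then have ext: "y \<in> extensional {1..k+1}"
    by (auto simp: D_set_def m_k_def space_PiM PiE_iff)
  have "y i \<in> ball 0 t" if i: "i \<in> {1..k+1}" for i
  proof -
    from h show ?thesis
    proof (elim insertE emptyE)
      assume "h = h_plus k"
      \<comment> \<open>The ball left out must belong neither to the origin nor to
        \<open>y i\<close>. Such an index exists because \<open>k + 2\<close> is at least 3.\<close>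
      obtain l where l: "l \<in> {1..k+2}" "l \<noteq> 1" "l \<noteq> Suc i"
      proof (cases "i = 1")
        case True
        then show ?thesis using that[of 3] assms by simp
      next
        case False
        then show ?thesis using that[of 2] i by simp
      qed
      then have "y \<in> ball_meet k ({1..k+2} - {l}) t"
        using y \<open>h = h_plus k\<close> by (auto simp: D_set_h_plus)
      then show ?thesis
        using l i by (intro ball_meet_bound[of y k "{1..k+2} - {l}" t]) auto
    next
      assume "h = h_minus k"
      then show ?thesis
        using y i by (intro ball_meet_bound[of y k "{1..k+2}" t]) (auto simp: D_set_h_minus)
    qed
  qed
  with ext show "y \<in> (\<Pi>\<^sub>E i\<in>{1..k+1}. ball 0 t)" by (simp add: PiE_iff)
qed

lemma D_set_zero:
  assumes "1 \<le> k"
  shows "D_set k h 0 = {}"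
proof -
  have "(\<Pi>\<^sub>E i\<in>{1..k+1}. ball (0 :: real ^ 'd) 0) = {}"
    by (subst PiE_eq_empty_iff) auto
  then show ?thesis
    using D_set_bounded[OF assms, of 0] by simp
qed

lemma D_set_finite_measure:
  assumes "1 \<le> k"
  shows "emeasure (m_k k) (D_set k h t) < \<infinity>"
proof -
  interpret product_sigma_finite "\<lambda>_::nat. lborel :: (real ^ 'd) measure" ..
  have "emeasure (m_k k) (D_set k h t) \<le> emeasure (m_k k) (\<Pi>\<^sub>E i\<in>{1..k+1}. ball (0 :: real ^ 'd) t)"
    unfolding m_k_def by (intro emeasure_mono D_set_bounded[OF assms] sets_PiM_I_finite) auto
  also have "\<dots> = (\<Prod>i\<in>{1..k+1}. emeasure lborel (ball (0 :: real ^ 'd) t))"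
    unfolding m_k_def by (intro emeasure_PiM) auto
  also have "\<dots> < \<infinity>"
    using emeasure_lborel_ball_finite[of "0 :: real ^ 'd" t]
    by (simp add: power_less_top_ennreal ennreal_mult_less_top)
  finally show ?thesis .
qed

lemma measure_D_set:
  assumes "1 \<le> k" "0 \<le> t"
  shows "measure (m_k k) (D_set k h t) = measure (m_k k) (D_set k h 1) * t ^ (CARD('d) * (k + 1))"
proof (cases "t = 0")
  \<comment> \<open>The scaling formula needs a positive factor. At 0 both sides vanish: the set is
    empty and the exponent is positive.\<close>
  case True
  then show ?thesis using D_set_zero[OF assms(1)] by simp
next
  case False
  with assms have t: "0 < t" by simp
  \<comment> \<open>The set at time 1 is the preimage of the set at time \<open>t\<close> under the
    dilation by \<open>t\<close>.\<close>
  have "(\<lambda>y. \<lambda>i\<in>{1..k+1}. t *\<^sub>R y i) -` D_set k h t \<inter> space (m_k k) = D_set k h 1"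
    using D_set_scaleR[OF t] by (auto simp: D_set_def[of k h 1])
  then have "emeasure (m_k k) (D_set k h t) =
      ennreal (t ^ (CARD('d) * (k + 1))) * emeasure (m_k k) (D_set k h 1)"
    using emeasure_PiM_lborel_scaleR_vimage[OF finite_atLeastAtMost sets_D_set[unfolded m_k_def] t, of t]
    unfolding m_k_def[symmetric] by (simp only: DIM_cart DIM_real card_atLeastAtMost mult_1_right diff_Suc_1 Suc_eq_plus1[symmetric] add_0)
  then show ?thesis
    using t by (simp add: measure_def enn2real_mult)
qed

end

section \<open>The Gaussian process as a time-changed Brownian motion\<close>

theorem proposition3p1:
  fixes f :: "real ^ 'd \<Rightarrow> real"
    and k :: nat
    and M :: "'w measure"
    and G :: "(nat \<Rightarrow> real ^ 'd) set \<Rightarrow> 'w \<Rightarrow> real"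
    and N :: "'v measure"
    and B :: "real \<Rightarrow> 'v \<Rightarrow> real"
  assumes "2 \<le> CARD('d)"
    and "1 \<le> k" and "k < CARD('d)"
    and "prob_density f"
    and "\<exists>b. AE x in lebesgue. f x \<le> b"
    and "AE x in lebesgue. isCont f x"
    and "gaussian_random_measure M (scale_measure (ennreal (C_const f k)) (m_k k)) G"
    and "standard_brownian_motion N B"
  shows "\<forall>h\<in>{h_plus k, h_minus k}.
    fdd_eq M N {0..}
      (\<lambda>t. gaussian_integral M (scale_measure (ennreal (C_const f k)) (m_k k)) G
              (\<lambda>y. h t (cons0 y)))
      (\<lambda>t. B (C_const f k * measure (m_k k) (D_set k h 1) * t ^ (CARD('d) * (k + 1))))"
proof
  fix h :: "real \<Rightarrow> (nat \<Rightarrow> real ^ 'd) \<Rightarrow> real" assume h: "h \<in> {h_plus k, h_minus k}"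
  define \<nu> :: "(nat \<Rightarrow> real ^ 'd) measure" where "\<nu> = scale_measure (ennreal (C_const f k)) (m_k k)"
  define X where "X t = gaussian_integral M \<nu> G (\<lambda>y. h t (cons0 y))" for t
  define D where "D = D_set k h"
  define p where "p = CARD('d) * (k + 1)"
  define c where "c = C_const f k * measure (m_k k) (D 1)"
  have grm: "gaussian_random_measure M \<nu> G"
    using assms(7) by (simp add: \<nu>_def)
  then interpret M: prob_space M by (simp add: gaussian_random_measure_def)
  note bm = \<open>standard_brownian_motion N B\<close>[unfolded standard_brownian_motion_def]
  have N: "prob_space N" using bm by blast
  have B_indep: "prob_space.indep_vars N (\<lambda>_. borel) (\<lambda>i w. B (\<sigma> (Suc i)) w - B (\<sigma> i) w) {..<n}"
    if "0 \<le> \<sigma> 0" "mono_on {..n} \<sigma>" for \<sigma> :: "nat \<Rightarrow> real" and n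
    using bm that by blast
  \<comment> \<open>By this, scaling by \<open>ennreal (C_const f k)\<close> multiplies measures by
    the constant itself, and the clock \<open>c * t ^ p\<close> is nondecreasing.\<close>
  have C0: "0 \<le> C_const f k"
    using \<open>prob_density f\<close> by (auto simp: C_const_def prob_density_def intro!: Bochner_Integration.integral_nonneg)
  have c0: "0 \<le> c" by (simp add: c_def C0)
  have p0: "0 < p" by (simp add: p_def)
  have sD: "D t \<in> sets \<nu>" for t
    using sets_D_set[OF h, of t] by (simp add: \<nu>_def D_def)
  have fD: "emeasure \<nu> (D t) < \<infinity>" for t
    using D_set_finite_measure[OF h \<open>1 \<le> k\<close>, of t] by (simp add: \<nu>_def D_def ennreal_mult_less_top)
  have mD: "measure \<nu> (D t) = c * t ^ p" if "0 \<le> t" for t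
    using measure_D_set[OF h \<open>1 \<le> k\<close> that] C0
    by (simp add: \<nu>_def D_def c_def p_def)
  have monoD: "D s \<subseteq> D t" if "s \<le> t" for s t
    using D_set_mono[OF h that] by (simp add: D_def)
  have ind: "h t (cons0 y) = indicator (D t) y" if "y \<in> space \<nu>" for t y
    using h_eq_indicator[OF h, of y t] that by (simp add: \<nu>_def D_def space_scale_measure)
  have Xm: "X t \<in> borel_measurable M" for t
    unfolding X_def using gaussian_integral_indicator(1)[OF grm sD fD ind] .
  have XG: "AE w in M. X t w = G (D t) w" for t
    unfolding X_def using gaussian_integral_indicator(2)[OF grm sD fD ind] .
  have sDD: "D t - D s \<in> sets \<nu>" for s t using sD by blast
  have fDD: "emeasure \<nu> (D t - D s) < \<infinity>" for s t
    using emeasure_mono[of "D t - D s" "D t" \<nu>] sD fD[of t] by (auto intro: le_less_trans)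
  \<comment> \<open>As the sets are nested, an increment of the process is almost surely the value
    of \<open>G\<close> on the shell \<open>D t - D s\<close>.\<close>
  have inc: "AE w in M. X t w - X s w = G (D t - D s) w" if "s \<le> t" for s t
    using XG[of s] XG[of t] grm_diff[OF grm sD sD monoD[OF that] fD] by eventually_elim simp
  have power_mono': "c * s ^ p \<le> c * t ^ p" if "0 \<le> s" "s \<le> t" for s t
    using that c0 by (intro mult_left_mono power_mono)
  have "fdd_eq M N {0..} X (\<lambda>t. B (c * t ^ p))"
  proof (rule fdd_eq_independent_increments[OF M.prob_space_axioms N])
    fix t :: real assume "0 \<le> t"
    then show "B (c * t ^ p) \<in> borel_measurable N" using bm c0 by simp
  next
    have "D 0 = {}" using D_set_zero[OF h \<open>1 \<le> k\<close>] by (simp add: D_def)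
    then show "AE w in M. X 0 w = 0"
      using XG[of 0] grm_empty[OF grm] by (auto elim: eventually_elim2)
    \<comment> \<open>Positivity of \<open>p\<close> makes the clock start at 0.\<close>
    have "c * 0 ^ p = 0" using p0 by simp
    then show "AE w in N. B (c * 0 ^ p) w = 0"
      using bm by (simp only:)
  next
    fix s t :: real assume st: "0 \<le> s" "s \<le> t"
    have "distr M borel (\<lambda>w. X t w - X s w) = distr M borel (G (D t - D s))"
      using Xm inc[OF st(2)] grm_measurable[OF grm sDD fDD] by (intro distr_cong_AE) auto
    also have "\<dots> = normal_law 0 (measure \<nu> (D t - D s))"
      by (rule grm_law[OF grm sDD fDD])
    also have "measure \<nu> (D t - D s) = c * t ^ p - c * s ^ p"
      using measure_Diff[OF _ sD sD monoD[OF st(2)]] fD[of t] st by (simp add: mD less_top)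
    \<comment> \<open>The variance on the shell is the Brownian time elapsed between the two clock
      readings.\<close>
    also have "normal_law 0 \<dots> = distr N borel (\<lambda>w. B (c * t ^ p) w - B (c * s ^ p) w)"
      using bm st c0 power_mono'[OF st] by simp
    finally show "distr M borel (\<lambda>w. X t w - X s w) = distr N borel (\<lambda>w. B (c * t ^ p) w - B (c * s ^ p) w)" .
  next
    fix \<tau> :: "nat \<Rightarrow> real" and n assume \<tau>: "0 \<le> \<tau> 0" "mono_on {..n} \<tau>"
    have step: "\<tau> i \<le> \<tau> j" if "i \<le> j" "j \<le> n" for i j
      using \<tau>(2) that by (auto simp: mono_on_def)
    have "M.indep_vars (\<lambda>_. borel) (\<lambda>i. G (D (\<tau> (Suc i)) - D (\<tau> i))) {..<n}"
    proof (rule grm_indep[OF grm sDD fDD])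
      \<comment> \<open>For \<open>i < j\<close> the outer set of the earlier shell lies inside the
        set removed from the later one.\<close>
      have "(D (\<tau> (Suc i)) - D (\<tau> i)) \<inter> (D (\<tau> (Suc j)) - D (\<tau> j)) = {}" if "i < j" "j < n" for i j
        using monoD[OF step[of "Suc i" j]] that by auto
      then show "disjoint_family_on (\<lambda>i. D (\<tau> (Suc i)) - D (\<tau> i)) {..<n}"
        unfolding disjoint_family_on_def by (metis Int_commute lessThan_iff linorder_neqE_nat)
    qed
    \<comment> \<open>Increments agree with shell values only almost surely, so independence has to
      be transferred.\<close>
    then show "M.indep_vars (\<lambda>_. borel) (\<lambda>i w. X (\<tau> (Suc i)) w - X (\<tau> i) w) {..<n}"
    proof (rule M.indep_vars_cong_AE)
      fix i assume "i \<in> {..<n}"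
      then show "AE w in M. G (D (\<tau> (Suc i)) - D (\<tau> i)) w = X (\<tau> (Suc i)) w - X (\<tau> i) w"
        using inc[OF step[of i "Suc i"]] by (auto elim: eventually_mono)
    qed (auto intro!: borel_measurable_diff Xm)
    have "0 \<le> \<tau> i" if "i \<le> n" for i
      using step[of 0 i] \<tau>(1) that by simp
    \<comment> \<open>The monotone clock sends the time grid to an admissible grid for
      \<open>B\<close>.\<close>
    then have "mono_on {..n} (\<lambda>i. c * \<tau> i ^ p)"
      by (intro mono_onI power_mono' step) auto
    moreover have "0 \<le> c * \<tau> 0 ^ p" using c0 \<tau>(1) by simp
    ultimately show "prob_space.indep_vars N (\<lambda>_. borel)
        (\<lambda>i w. B (c * \<tau> (Suc i) ^ p) w - B (c * \<tau> i ^ p) w) {..<n}"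
      by (intro B_indep[of "\<lambda>i. c * \<tau> i ^ p"])
  qed (rule Xm)
  then show "fdd_eq M N {0..}
      (\<lambda>t. gaussian_integral M (scale_measure (ennreal (C_const f k)) (m_k k)) G (\<lambda>y. h t (cons0 y)))
      (\<lambda>t. B (C_const f k * measure (m_k k) (D_set k h 1) * t ^ (CARD('d) * (k + 1))))"
    by (simp only: X_def[abs_def] \<nu>_def c_def D_def p_def)
qed

end
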